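(* Let $u$ be a positive integer with $u\equiv 3$ or $7 \pmod{10}$. Suppose that one of the following two conditions holds: (1) $v_2(u^2-1)$ is even; (2) there exists an odd prime $p$ with $p\equiv 2,3$ or $4\pmod 5$ such that $v_p(u+1)$ is odd or $v_p(u-1)$ is odd. Then there does not exist a $\left(\tfrac12(u^2+1),\ \tfrac14(u-1)^2,\ \tfrac18(u-1)(u-3)\right)$ cyclic difference set. Equivalently, there is no binary sequence $\mathbf a$ of period $n=\tfrac12(u^2+1)$ with $C_{\mathbf a}(t)=1$ for all $1\le t\le n-1$.
   Context: For a prime $p$ and a nonzero integer $m$, $v_p(m)$ denotes the exponent of the highest power of $p$ dividing $m$ ($v_p(0)=\infty$). An $(n,k,\lambda)$ cyclic difference set is a $k$-element subset $D$ of a cyclic group $G$ of order $n$ such that every non-identity element $g\in G$ has exactly $\lambda$ representations $g=xy^{-1}$ with $x,y\in D$. A binary sequence of period $n$ is $\mathbf a=(a_0,a_1,\ldots)$ with $a_j\in\{-1,1\}$, $a_{j+n}=a_j$; its autocorrelation values are $C_{\mathbf a}(t)=\sum_{i=0}^{n-1}a_ia_{i+t}$. *)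

theory Defs
  imports "HOL-Algebra.Elementary_Groups" "HOL-Computational_Algebra.Primes"
begin

definition cyclic_difference_set :: "'a monoid \<Rightarrow> 'a set \<Rightarrow> nat \<Rightarrow> nat \<Rightarrow> nat \<Rightarrow> bool" where
  "cyclic_difference_set G D n k l \<longleftrightarrow>
     group G \<and> cyclic_group G \<and> finite (carrier G) \<and> order G = n \<and>
     D \<subseteq> carrier G \<and> card D = k \<and>
     (\<forall>g \<in> carrier G - {\<one>\<^bsub>G\<^esub>}.
        card {(x, y). x \<in> D \<and> y \<in> D \<and> g = x \<otimes>\<^bsub>G\<^esub> inv\<^bsub>G\<^esub> y} = l)"

text \<open>The number \<open>n\<close> is a period of the sequence, not necessarily the least one.\<close>

definition binary_sequence :: "nat \<Rightarrow> (nat \<Rightarrow> int) \<Rightarrow> bool" where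
  "binary_sequence n a \<longleftrightarrow> n > 0 \<and> (\<forall>j. a j \<in> {-1, 1}) \<and> (\<forall>j. a (j + n) = a j)"

definition autocorrelation :: "nat \<Rightarrow> (nat \<Rightarrow> int) \<Rightarrow> nat \<Rightarrow> int" where
  "autocorrelation n a t = (\<Sum>i = 0..<n. a i * a (i + t))"

end

theory Submission
  imports Defs "HOL-Library.Poly_Mapping" "HOL-Number_Theory.Cong" "HOL-Algebra.Multiplicative_Group" "HOL-Library.Numeral_Type"
begin

text \<open>Reduce the sequence modulo 5 (note \<open>5 dvd n\<close>) to an element \<open>A\<close> of \<open>\<int>[C\<^sub>5]\<close>. The product of \<open>A\<close> with its
  conjugate is \<open>n - 1\<close> plus a multiple of the sum of all group elements. For a prime \<open>p\<close> with
  \<open>p\<^sup>j = -1\<close> modulo 5, Frobenius identifies the conjugate of \<open>A\<close> with a power of \<open>A\<close> modulo \<open>p\<close>.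
  Hence if \<open>p\<close> divides \<open>n - 1\<close>, all coefficients of \<open>A\<close> agree modulo \<open>p\<close>; subtracting a constant and
  dividing by \<open>p\<close> replaces \<open>n - 1\<close> by \<open>(n - 1) / p\<^sup>2\<close>, so \<open>p\<close> occurs in \<open>n - 1 = (u\<^sup>2 - 1) / 2\<close> to an even power.
  A difference set with the given parameters yields such a sequence through its \<open>\<plusminus>1\<close> indicator.\<close>

section \<open>Frobenius congruences modulo a prime\<close>

lemma of_nat_prime_dvd_frobenius_add:
  fixes x y :: "'a::comm_ring_1"
  assumes "prime p"
  shows "of_nat p dvd (x + y) ^ p - (x ^ p + y ^ p)"
proof -
  let ?t = "\<lambda>k. of_nat (p choose k) * x ^ k * y ^ (p - k)"
  have p0: "0 < p" using assms prime_gt_0_nat by blast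
  have "{..p} = insert 0 (insert p {0<..<p})" by auto
  hence "(x + y) ^ p = sum ?t (insert 0 (insert p {0<..<p}))"
    by (simp only: binomial_ring)
  also have "\<dots> = y ^ p + (x ^ p + sum ?t {0<..<p})"
    using p0 by simp
  finally have "(x + y) ^ p - (x ^ p + y ^ p) = sum ?t {0<..<p}"
    by simp
  moreover have "of_nat p dvd sum ?t {0<..<p}"
  proof (rule dvd_sum)
    fix k assume "k \<in> {0<..<p}"
    hence "p dvd p choose k" using assms by (intro dvd_choose_prime) auto
    hence "of_nat p dvd (of_nat (p choose k) :: 'a)" by (auto elim!: dvdE)
    thus "of_nat p dvd ?t k" by (intro dvd_mult2)
  qed
  ultimately show ?thesis by simp
qed

lemma dvd_diff_trans:
  fixes d :: "'a::comm_ring_1"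
  assumes "d dvd x - y" "d dvd y - z"
  shows "d dvd x - z"
  using dvd_add[OF assms] by simp

lemma dvd_power_diff:
  fixes d :: "'a::comm_ring_1"
  assumes "d dvd x - y"
  shows "d dvd x ^ n - y ^ n"
  using assms by (metis dvd_mult2 power_diff_sumr2)

lemma of_nat_prime_dvd_frobenius_sum:
  fixes f :: "'b \<Rightarrow> 'a::comm_ring_1"
  assumes "prime p"
  shows "of_nat p dvd sum f S ^ p - (\<Sum>s\<in>S. f s ^ p)"
proof (induction S rule: infinite_finite_induct)
  case (insert s S)
  have "of_nat p dvd (f s + sum f S) ^ p - (f s ^ p + sum f S ^ p)
      + (sum f S ^ p - (\<Sum>s\<in>S. f s ^ p))"
    by (intro dvd_add of_nat_prime_dvd_frobenius_add assms insert.IH)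
  thus ?case using insert by (simp add: algebra_simps)
qed (use assms prime_gt_0_nat in \<open>auto simp: power_0_left\<close>)

text \<open>Frobenius with second summand 1 carries the claim from an integer to its neighbours;
  group ring coefficients may be negative, hence the induction in both directions.\<close>

lemma prime_dvd_int_power_diff:
  assumes "prime p"
  shows "int p dvd a ^ p - a"
proof (induction a rule: int_induct[where k = 0])
  case base
  show ?case using assms prime_gt_0_nat by (auto simp: power_0_left)
next
  case (step1 i)
  have "int p dvd ((i + 1) ^ p - (i ^ p + 1 ^ p)) + (i ^ p - i)"
    using of_nat_prime_dvd_frobenius_add[OF assms, of i 1] step1 by (intro dvd_add) auto
  thus ?case by (simp add: algebra_simps)
next
  case (step2 i)
  have "int p dvd (i ^ p - i) - (((i - 1) + 1) ^ p - ((i - 1) ^ p + 1 ^ p))"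
    using dvd_diff[OF step2(2) of_nat_prime_dvd_frobenius_add[OF assms, of "i - 1" 1]] by simp
  also have "(i ^ p - i) - (((i - 1) + 1) ^ p - ((i - 1) ^ p + 1 ^ p)) = (i - 1) ^ p - (i - 1)"
    by simp
  finally show ?case .
qed

section \<open>The integral group ring of a finite additive group\<close>

text \<open>Multiplication of \<open>Poly_Mapping\<close> is convolution, so exponents add. The ring
  structure on \<open>'g\<close> lets the \<open>n\<close>-th power of a group element be written as
  a product with \<open>of_nat n\<close>.\<close>

lemma single_power:
  "Poly_Mapping.single (g::'g::comm_ring_1) (a::int) ^ n = Poly_Mapping.single (of_nat n * g) (a ^ n)"
  by (induction n) (simp_all add: mult_single algebra_simps)

lemma single_of_nat_mult:
  "Poly_Mapping.single g (int p * a) = of_nat p * Poly_Mapping.single (g::'g::comm_ring_1) a"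
  by (simp add: mult_single flip: single_of_nat)

lemma lookup_of_nat_mult:
  "Poly_Mapping.lookup (of_nat p * X) (g::'g::comm_ring_1) = int p * Poly_Mapping.lookup X g"
  by (induction p) (simp_all add: algebra_simps lookup_add)

text \<open>The function \<open>h\<close> carries the action of multipliers (such as \<open>-1\<close> and \<open>p\<^sup>j\<close>) on group elements.\<close>

definition group_ring_sum :: "('g::{finite,comm_ring_1} \<Rightarrow> 'g) \<Rightarrow> ('g \<Rightarrow> int) \<Rightarrow> 'g \<Rightarrow>\<^sub>0 int" where
  "group_ring_sum h f = (\<Sum>g\<in>UNIV. Poly_Mapping.single (h g) (f g))"

lemma lookup_group_ring_sum [simp]:
  "Poly_Mapping.lookup (group_ring_sum (\<lambda>g. g) f) g = f g"
  by (simp add: group_ring_sum_def lookup_sum lookup_single when_def)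

lemma group_ring_sum_lookup: "group_ring_sum (\<lambda>g. g) (Poly_Mapping.lookup X) = X"
  by (rule poly_mapping_eqI) simp

text \<open>Modulo \<open>p\<close> the mixed terms vanish and each coefficient equals its own
  \<open>p\<close>-th power, so only the group elements change: they get multiplied by
  \<open>p\<close>.\<close>

lemma group_ring_sum_frobenius:
  assumes "prime p"
  shows "of_nat p dvd group_ring_sum h f ^ p - group_ring_sum (\<lambda>g. of_nat p * h g) f"
proof (rule dvd_diff_trans)
  let ?S = "\<lambda>e. \<Sum>g\<in>UNIV. Poly_Mapping.single (of_nat p * h g) (e g)"
  show "of_nat p dvd group_ring_sum h f ^ p - ?S (\<lambda>g. f g ^ p)"
    using of_nat_prime_dvd_frobenius_sum[OF assms, of "\<lambda>g. Poly_Mapping.single (h g) (f g)" UNIV]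
    by (simp add: group_ring_sum_def single_power)
  have "of_nat p dvd (\<Sum>g\<in>UNIV. Poly_Mapping.single (of_nat p * h g) (f g ^ p - f g))"
  proof (rule dvd_sum)
    fix g
    obtain c where "f g ^ p - f g = int p * c"
      using prime_dvd_int_power_diff[OF assms, of "f g"] by (auto elim: dvdE)
    thus "of_nat p dvd Poly_Mapping.single (of_nat p * h g) (f g ^ p - f g)"
      by (simp add: single_of_nat_mult)
  qed
  thus "of_nat p dvd ?S (\<lambda>g. f g ^ p) - group_ring_sum (\<lambda>g. of_nat p * h g) f"
    by (simp add: group_ring_sum_def single_diff sum_subtractf)
qed

lemma group_ring_sum_frobenius_power:
  assumes "prime p"
  shows "of_nat p dvd group_ring_sum (\<lambda>g. g) f ^ (p ^ k)
           - group_ring_sum (\<lambda>g. of_nat (p ^ k) * g) f"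
proof (induction k)
  case (Suc k)
  have "of_nat p dvd (group_ring_sum (\<lambda>g. g) f ^ (p ^ k)) ^ p
           - group_ring_sum (\<lambda>g. of_nat (p ^ k) * g) f ^ p"
    by (rule dvd_power_diff[OF Suc])
  from dvd_diff_trans[OF this group_ring_sum_frobenius[OF assms]] show ?case
    by (simp add: mult.commute mult.left_commute flip: power_mult)
qed simp

text \<open>Translation by a group element permutes the group, so a factor \<open>X\<close> merely
  scales the sum of all elements by the coefficient sum of \<open>X\<close>.\<close>

lemma mult_all_ones:
  "X * group_ring_sum (\<lambda>g. g) (\<lambda>_. 1) = group_ring_sum (\<lambda>g. g) (\<lambda>_. \<Sum>g\<in>UNIV. Poly_Mapping.lookup X g)"
proof -
  have shift: "Poly_Mapping.single h a * group_ring_sum (\<lambda>g. g) (\<lambda>_. 1) = group_ring_sum (\<lambda>g. g) (\<lambda>_. a)"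
    for h :: 'a and a :: int
    unfolding group_ring_sum_def sum_distrib_left mult_single
    by (rule sum.reindex_bij_witness[of _ "\<lambda>g. g - h" "\<lambda>g. h + g"]) auto
  have X: "X = (\<Sum>h\<in>UNIV. Poly_Mapping.single h (Poly_Mapping.lookup X h))"
    using group_ring_sum_lookup[of X] by (simp add: group_ring_sum_def)
  have "X * group_ring_sum (\<lambda>g. g) (\<lambda>_. 1)
      = (\<Sum>h\<in>UNIV. Poly_Mapping.single h (Poly_Mapping.lookup X h)) * group_ring_sum (\<lambda>g. g) (\<lambda>_. 1)"
    by (rule arg_cong[OF X, of "\<lambda>Y. Y * _"])
  also have "\<dots> = (\<Sum>h\<in>UNIV. group_ring_sum (\<lambda>g. g) (\<lambda>_. Poly_Mapping.lookup X h))"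
    by (simp add: sum_distrib_right shift)
  also have "\<dots> = group_ring_sum (\<lambda>g. g) (\<lambda>_. \<Sum>g\<in>UNIV. Poly_Mapping.lookup X g)"
    by (rule poly_mapping_eqI) (simp add: lookup_sum)
  finally show ?thesis .
qed

section \<open>Autocorrelation on a finite group and self-conjugate primes\<close>

definition group_autocorrelation :: "('g::{finite,ab_group_add} \<Rightarrow> int) \<Rightarrow> 'g \<Rightarrow> int" where
  "group_autocorrelation f t = (\<Sum>g\<in>UNIV. f (g + t) * f g)"

text \<open>The coefficient at \<open>t\<close> collects the pairs with difference
  \<open>t\<close>.\<close>

lemma group_ring_sum_mult_conjugate:
  "group_ring_sum (\<lambda>g. g) f * group_ring_sum uminus f = group_ring_sum (\<lambda>g. g) (group_autocorrelation f)"
proof -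
  have "group_ring_sum (\<lambda>g. g) f * group_ring_sum uminus f
      = (\<Sum>h\<in>UNIV. \<Sum>g\<in>UNIV. Poly_Mapping.single (g - h) (f g * f h))"
    unfolding group_ring_sum_def sum_product mult_single
    by (subst sum.swap) simp
  also have "\<dots> = (\<Sum>h\<in>UNIV. \<Sum>t\<in>UNIV. Poly_Mapping.single t (f (h + t) * f h))"
  proof (rule sum.cong[OF refl])
    fix h
    show "(\<Sum>g\<in>UNIV. Poly_Mapping.single (g - h) (f g * f h))
        = (\<Sum>t\<in>UNIV. Poly_Mapping.single t (f (h + t) * f h))"
      by (rule sum.reindex_bij_witness[of _ "\<lambda>t. h + t" "\<lambda>g. g - h"]) auto
  qed
  also have "\<dots> = (\<Sum>t\<in>UNIV. Poly_Mapping.single t (group_autocorrelation f t))"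
    unfolding group_autocorrelation_def
    by (subst sum.swap) (intro sum.cong refl poly_mapping_eqI, simp add: lookup_sum lookup_single when_def)
  finally show ?thesis by (simp add: group_ring_sum_def)
qed

text \<open>If \<open>p\<^sup>j\<close> acts as \<open>-1\<close> on the group, then modulo \<open>p\<close> the conjugate of \<open>A\<close> is the power
  \<open>A^(p^j)\<close> and \<open>A^(p^(2 j))\<close> is \<open>A\<close>, so \<open>A\<close> is a multiple of \<open>A\<close> times its conjugate.\<close>

lemma self_conjugate_prime_imp_constant_mod:
  fixes f :: "'g::{finite,comm_ring_1} \<Rightarrow> int"
  assumes p: "prime p" and j: "j > 0" "of_nat (p ^ j) = (-1 :: 'g)"
    and corr: "\<And>t. t \<noteq> 0 \<Longrightarrow> group_autocorrelation f 0 - group_autocorrelation f t = int m"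
    and "p dvd m"
  shows "int p dvd f g - f h"
proof -
  define A where "A = group_ring_sum (\<lambda>g. g) f"
  define J where "J = (group_ring_sum (\<lambda>g. g) (\<lambda>_. 1) :: 'g \<Rightarrow>\<^sub>0 int)"
  define q where "q = p ^ j"
  \<comment> \<open>By \<open>corr\<close>, this is the common autocorrelation at all nonzero
    shifts.\<close>
  define c where "c = group_autocorrelation f 0 - int m"
  define P where "P = (of_nat p :: 'g \<Rightarrow>\<^sub>0 int)"
  have "p \<ge> 2" using p prime_ge_2_nat by blast
  with j(1) have q2: "q \<ge> 2" unfolding q_def
    using self_le_power[of p j] by linarith
  \<comment> \<open>As \<open>q\<close> is at least 2, the truncated subtraction is exact, and
    \<open>A ^ (q * q)\<close> has the factor \<open>A * A ^ q\<close>.\<close>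
  have exponent: "q * q = (q * q - q - 1) + (1 + q)"
  proof -
    have "q * q \<ge> 2 * q" using q2 by (rule mult_le_mono1)
    thus ?thesis using q2 by linarith
  qed
  have conj: "P dvd A ^ q - group_ring_sum uminus f"
    using group_ring_sum_frobenius_power[OF p, of f j] j(2)
    unfolding A_def q_def P_def by simp
  have "of_nat (p ^ (j + j)) = (1 :: 'g)"
    unfolding power_add of_nat_mult j(2) by simp
  hence period: "P dvd A ^ (q * q) - A"
    using group_ring_sum_frobenius_power[OF p, of f "j + j"]
    unfolding A_def q_def P_def power_add by simp
  obtain e where e: "m = p * e" using \<open>p dvd m\<close> by (auto elim: dvdE)
  \<comment> \<open>The coefficients are \<open>c\<close> away from 0 and \<open>c + m\<close> at 0;
    since \<open>p\<close> divides \<open>m\<close>, only the multiple of \<open>J\<close> survives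
    modulo \<open>p\<close>.\<close>
  have "A * group_ring_sum uminus f = P * Poly_Mapping.single 0 (int e) + Poly_Mapping.single 0 c * J"
  proof (rule poly_mapping_eqI)
    fix t
    have J: "Poly_Mapping.single 0 c * J = group_ring_sum (\<lambda>g. g) (\<lambda>_. c)"
      unfolding J_def mult_all_ones by (simp add: lookup_single when_def)
    show "Poly_Mapping.lookup (A * group_ring_sum uminus f) t
        = Poly_Mapping.lookup (P * Poly_Mapping.single 0 (int e) + Poly_Mapping.single 0 c * J) t"
      unfolding A_def group_ring_sum_mult_conjugate J
      using corr[of t]
      by (cases "t = 0") (simp_all add: P_def lookup_add lookup_of_nat_mult lookup_single when_def c_def e del: single_of_nat)
  qed
  hence norm: "P dvd A * group_ring_sum uminus f - Poly_Mapping.single 0 c * J"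
    by simp
  define B where "B = A ^ (q * q - q - 1)"
  have power_qq: "A ^ (q * q) = B * (A * A ^ q)"
    by (subst exponent) (simp only: B_def power_add power_one_right)
  have "P dvd B * A * (A ^ q - group_ring_sum uminus f)"
    using conj by (rule dvd_mult)
  moreover have "P dvd B * (A * group_ring_sum uminus f - Poly_Mapping.single 0 c * J)"
    using norm by (rule dvd_mult)
  moreover have "B * A * (A ^ q - group_ring_sum uminus f)
      + B * (A * group_ring_sum uminus f - Poly_Mapping.single 0 c * J)
      = A ^ (q * q) - B * Poly_Mapping.single 0 c * J"
    unfolding power_qq right_diff_distrib by (simp add: mult.assoc)
  ultimately have "P dvd A ^ (q * q) - B * Poly_Mapping.single 0 c * J"
    using dvd_add by metis
  from dvd_diff[OF this period] have "P dvd A - B * Poly_Mapping.single 0 c * J"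
    by simp
  then obtain X where X: "A - B * Poly_Mapping.single 0 c * J = P * X" by (auto elim: dvdE)
  \<comment> \<open>A multiple of \<open>J\<close> has all coefficients equal, here to
    \<open>s\<close>, so every value of \<open>f\<close> is congruent to \<open>s\<close>.\<close>
  define s where "s = (\<Sum>g\<in>UNIV. Poly_Mapping.lookup (B * Poly_Mapping.single 0 c) g)"
  have "f g - s = int p * Poly_Mapping.lookup X g" for g
    using arg_cong[OF X, of "\<lambda>Y. Poly_Mapping.lookup Y g"]
    by (simp add: A_def J_def mult_all_ones lookup_minus s_def P_def lookup_of_nat_mult)
  hence "int p dvd f g - s" for g by simp
  from dvd_diff[OF this[of g] this[of h]] show ?thesis by simp
qed

text \<open>Descent on \<open>m\<close> with \<open>f\<close> free to change: each round removes
  exactly two factors \<open>p\<close> from \<open>m\<close>, until \<open>p\<close> no longer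
  divides it.\<close>

lemma even_multiplicity_self_conjugate_prime:
  fixes f :: "'g::{finite,comm_ring_1} \<Rightarrow> int"
  assumes p: "prime p" and j: "j > 0" "of_nat (p ^ j) = (-1 :: 'g)"
    and "m > 0"
    and "\<And>t. t \<noteq> 0 \<Longrightarrow> group_autocorrelation f 0 - group_autocorrelation f t = int m"
  shows "even (multiplicity p m)"
  using assms(4,5)
proof (induction m arbitrary: f rule: less_induct)
  case (less m)
  show ?case
  proof (cases "p dvd m")
    case True
    define f' where "f' g = (f g - f 0) div int p" for g
    have f: "f g = f 0 + int p * f' g" for g
      using self_conjugate_prime_imp_constant_mod[OF p j less.prems(2) True, of g 0]
      by (simp add: f'_def)
    have shift: "(\<Sum>g\<in>UNIV. f' (g + t)) = (\<Sum>g\<in>UNIV. f' g)" for t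
      by (rule sum.reindex_bij_witness[of _ "\<lambda>g. g - t" "\<lambda>g. g + t"]) auto
    \<comment> \<open>The first two terms do not depend on \<open>t\<close> and cancel in the
      difference between shift 0 and shift \<open>t\<close>, which leaves the factor
      \<open>p\<^sup>2\<close>.\<close>
    have corr: "group_autocorrelation f t = of_nat CARD('g) * (f 0)\<^sup>2
        + 2 * f 0 * int p * (\<Sum>g\<in>UNIV. f' g) + (int p)\<^sup>2 * group_autocorrelation f' t" for t
    proof -
      have "group_autocorrelation f t = (\<Sum>g\<in>UNIV. (f 0)\<^sup>2 + f 0 * int p * f' (g + t)
          + f 0 * int p * f' g + (int p)\<^sup>2 * (f' (g + t) * f' g))"
        unfolding group_autocorrelation_def
        by (intro sum.cong refl, subst f, subst (2) f) (simp add: algebra_simps power2_eq_square)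
      thus ?thesis
        by (simp add: sum.distrib shift group_autocorrelation_def flip: sum_distrib_left)
    qed
    have eq: "(int p)\<^sup>2 * (group_autocorrelation f' 0 - group_autocorrelation f' t) = int m"
      if "t \<noteq> 0" for t
      using less.prems(2)[OF that] unfolding corr by (simp add: algebra_simps)
    have "(1::'g) \<noteq> 0" by simp
    from eq[OF this] have "(int p)\<^sup>2 dvd int m" by (metis dvd_triv_left)
    hence "p\<^sup>2 dvd m" by (metis of_nat_dvd_iff of_nat_power)
    then obtain m' where m': "m = p\<^sup>2 * m'" by (auto elim: dvdE)
    have p2: "p \<ge> 2" using p prime_ge_2_nat by blast
    have "m' > 0" using m' \<open>m > 0\<close> by (cases m') auto
    have "m' < m" unfolding m' using p2 \<open>m' > 0\<close> by (simp add: power2_eq_square)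
       (metis One_nat_def Suc_1 less_le_trans n_less_m_mult_n one_less_mult Suc_le_lessD mult.commute)
    moreover have "group_autocorrelation f' 0 - group_autocorrelation f' t = int m'" if "t \<noteq> 0" for t
      using eq[OF that] p2 by (simp add: m')
    ultimately have "even (multiplicity p m')"
      using less.IH[of m' f'] \<open>m' > 0\<close> by blast
    moreover have "multiplicity p m = multiplicity p (p\<^sup>2) + multiplicity p m'"
      unfolding m' using \<open>m' > 0\<close> p p2
      by (intro prime_elem_multiplicity_mult_distrib) auto
    moreover have "multiplicity p (p\<^sup>2) = 2"
      using p by (intro multiplicity_same_power) (auto simp: not_prime_0)
    ultimately show ?thesis by simp
  qed (simp add: not_dvd_imp_multiplicity_0)
qed

section \<open>Folding a periodic sequence onto residue classes\<close>

lemma bij_betw_add_mod: "bij_betw (\<lambda>s. (i + s) mod n) {..<n} {..<n::nat}"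
proof (cases "n = 0")
  case False
  have "inj_on (\<lambda>s. (i + s) mod n) {..<n}"
  proof (rule inj_onI)
    fix s t assume st: "s \<in> {..<n}" "t \<in> {..<n}" "(i + s) mod n = (i + t) mod n"
    hence "[i + s = i + t] (mod n)" by (simp add: cong_def)
    hence "[s = t] (mod n)" by (simp only: cong_add_lcancel_nat)
    thus "s = t" using st by (simp add: cong_def)
  qed
  moreover have "(\<lambda>s. (i + s) mod n) ` {..<n} \<subseteq> {..<n}" using False by auto
  ultimately show ?thesis
    unfolding bij_betw_def by (simp add: endo_inj_surj)
qed auto

lemma periodic_add_mult:
  assumes "\<And>j. a (j + n) = a (j::nat)"
  shows "a (j + k * n) = a j"
  using assms by (induction k) (simp_all add: add.assoc[symmetric] add.commute[of n])

lemma periodic_mod: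
  assumes "\<And>j. a (j + n) = a (j::nat)"
  shows "a (j mod n) = a j"
  using periodic_add_mult[of a n "j mod n" "j div n"] assms by simp

text \<open>For the type \<open>5\<close> and a multiple \<open>n\<close> of 5, this is the image of
  one period under the map from the group ring of the integers modulo \<open>n\<close> to that of
  the integers modulo 5.\<close>

definition residue_sum :: "nat \<Rightarrow> (nat \<Rightarrow> int) \<Rightarrow> 'g::{finite,comm_ring_1} \<Rightarrow> int" where
  "residue_sum n a r = (\<Sum>i\<in>{..<n}. a i when of_nat i = r)"

lemma of_nat_mod_modulus:
  assumes "of_nat n = (0 :: 'g::comm_ring_1)"
  shows "of_nat (j mod n) = (of_nat j :: 'g)"
proof -
  have "(of_nat j :: 'g) = of_nat (n * (j div n) + j mod n)" by simp
  also have "\<dots> = of_nat (j mod n)" unfolding of_nat_add of_nat_mult assms by simp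
  finally show ?thesis by simp
qed

lemma sum_when_eq: "(\<Sum>r\<in>(UNIV::'g::finite set). (F r when x = r)) = (F x :: int)"
  by (simp add: when_def)

text \<open>Since \<open>n\<close> vanishes in \<open>'g\<close>, folding respects convolution, so
  the autocorrelations are folded in the same way as the sequence.\<close>

lemma group_autocorrelation_residue_sum:
  fixes t :: "'g::{finite,comm_ring_1}"
  assumes n: "of_nat n = (0 :: 'g)" and per: "\<And>j. a (j + n) = a j"
  shows "group_autocorrelation (residue_sum n a) t
       = (\<Sum>s<n. autocorrelation n a s when of_nat s = t)"
proof -
  have "group_autocorrelation (residue_sum n a) t
      = (\<Sum>r\<in>UNIV. \<Sum>i<n. (residue_sum n a (r + t) * a i when of_nat i = r))"
    unfolding group_autocorrelation_def
    by (simp add: residue_sum_def[of n a "_ :: 'g"] sum_distrib_left mult_when)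
  also have "\<dots> = (\<Sum>i<n. residue_sum n a (of_nat i + t) * a i)"
    by (subst sum.swap) (simp add: sum_when_eq)
  also have "\<dots> = (\<Sum>i<n. \<Sum>s<n. (a i * a (i + s) when of_nat s = t))"
  proof (rule sum.cong[OF refl])
    fix i
    have "residue_sum n a (of_nat i + t)
        = (\<Sum>s<n. (a ((i + s) mod n) when of_nat ((i + s) mod n) = of_nat i + t))"
      unfolding residue_sum_def
      by (rule sum.reindex_bij_betw[OF bij_betw_add_mod, symmetric])
    thus "residue_sum n a (of_nat i + t) * a i = (\<Sum>s<n. (a i * a (i + s) when of_nat s = t))"
      by (simp add: of_nat_mod_modulus[OF n] periodic_mod[of a, OF per] sum_distrib_left
          mult_when mult.commute[of _ "a i"])
  qed
  also have "\<dots> = (\<Sum>s<n. autocorrelation n a s when of_nat s = t)"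
    by (subst sum.swap) (auto intro!: sum.cong simp: when_def autocorrelation_def lessThan_atLeast0)
  finally show ?thesis .
qed

text \<open>The peak value \<open>n\<close> is 1 plus a surplus \<open>n - 1\<close>. The ones fold
  to the same amount at every shift and the surplus lands at 0, so the descent applies with
  \<open>m = n - 1\<close>.\<close>

lemma even_multiplicity_of_flat_autocorrelation:
  fixes a :: "nat \<Rightarrow> int"
  assumes p: "prime p" and j: "j > 0" "of_nat (p ^ j) = (-1 :: 5)"
    and "5 dvd n" "n > 0" and a: "binary_sequence n a"
    and C: "\<And>t. t \<in> {1..n - 1} \<Longrightarrow> autocorrelation n a t = 1"
  shows "even (multiplicity p (n - 1))"
proof -
  have n0: "of_nat n = (0 :: 5)"
  proof -
    obtain k where "n = 5 * k" using \<open>5 dvd n\<close> by (rule dvdE)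
    moreover have "of_nat 5 = (0 :: 5)" by simp
    ultimately show ?thesis by (simp only: of_nat_mult mult_zero_left)
  qed
  have per: "a (j + n) = a j" and sq: "a j * a j = 1" for j
    using a by (auto simp: binary_sequence_def) (metis insert_iff mult_minus1 singletonD minus_mult_minus mult_1 minus_minus)
  have "5 \<le> n" using assms(4,5) by (intro dvd_imp_le)
  have corr: "group_autocorrelation (residue_sum n a) t
      = (\<Sum>s<n. (1 when of_nat s = t)) + (int (n - 1) when t = 0)" for t :: 5
  proof -
    have eq: "(autocorrelation n a s when of_nat s = t)
        = (1 when of_nat s = t) + (if s = 0 then (int (n - 1) when t = 0) else 0)" if "s < n" for s
    proof (cases "s = 0")
      case True
      thus ?thesis using \<open>n > 0\<close> by (auto simp: autocorrelation_def sq when_def)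
    next
      case False
      thus ?thesis using that C[of s] by simp
    qed
    have "(\<Sum>s<n. autocorrelation n a s when of_nat s = t)
        = (\<Sum>s<n. (1 when of_nat s = t) + (if s = 0 then (int (n - 1) when t = 0) else 0))"
      by (intro sum.cong refl eq) simp
    thus ?thesis
      using \<open>n > 0\<close> by (simp add: group_autocorrelation_residue_sum[of n a, OF n0 per] sum.distrib)
  qed
  \<comment> \<open>Moving the index by a representative \<open>c\<close> of \<open>t\<close>
    carries class 0 to the class of \<open>t\<close>.\<close>
  have uniform: "(\<Sum>s<n. (1 when of_nat s = t)) = (\<Sum>s<n. (1::int) when of_nat s = (0::5))" for t :: 5
  proof (cases t)
    case (of_int z)
    define c where "c = nat z"
    have t: "t = of_nat c" using of_int by (simp add: c_def)
    have "(\<Sum>s<n. (1::int) when of_nat s = t) = (\<Sum>s<n. (1 when of_nat ((c + s) mod n) = t))"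
      by (rule sum.reindex_bij_betw[OF bij_betw_add_mod, symmetric])
    thus ?thesis by (simp add: of_nat_mod_modulus[OF n0] t)
  qed
  show ?thesis
  proof (rule even_multiplicity_self_conjugate_prime[OF p j])
    show "0 < n - 1" using \<open>5 \<le> n\<close> by simp
    show "group_autocorrelation (residue_sum n a) (0 :: 5) - group_autocorrelation (residue_sum n a) t
        = int (n - 1)" if "t \<noteq> 0" for t :: 5
      unfolding corr using that uniform[of t] by simp
  qed
qed

section \<open>From cyclic difference sets to binary sequences\<close>

text \<open>Exponents reduce modulo the order, so the powers below \<open>order G\<close> fill the
  group; equal cardinalities then give injectivity.\<close>

lemma (in group) bij_betw_nat_pow_generator:
  assumes "finite (carrier G)" "x \<in> carrier G" "carrier G = range (\<lambda>i::int. x [^] i)"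
  shows "bij_betw (\<lambda>i::nat. x [^] i) {..<order G} (carrier G)"
proof -
  let ?n = "order G"
  have n: "?n > 0" using assms(1) order_gt_0_iff_finite by blast
  have "carrier G \<subseteq> (\<lambda>i::nat. x [^] i) ` {..<?n}"
  proof
    fix y assume "y \<in> carrier G"
    then obtain i :: int where y: "y = x [^] i" using assms(3) by auto
    have "x [^] int ?n = \<one>" using pow_order_eq_1[OF assms(2)] by (simp add: int_pow_int)
    moreover have "x [^] (int ?n * (i div int ?n) + i mod int ?n)
        = (x [^] int ?n) [^] (i div int ?n) \<otimes> x [^] (i mod int ?n)"
      using assms(2) by (simp only: int_pow_mult int_pow_pow)
    ultimately have "y = x [^] (i mod int ?n)"
      unfolding y using assms(2) by simp
    hence "y = x [^] nat (i mod int ?n)" using n by (simp flip: int_pow_int)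
    moreover have "nat (i mod int ?n) < ?n" using n by (simp add: nat_less_iff)
    ultimately show "y \<in> (\<lambda>i::nat. x [^] i) ` {..<?n}" by blast
  qed
  hence im: "(\<lambda>i::nat. x [^] i) ` {..<?n} = carrier G" using assms(2) by auto
  hence "inj_on (\<lambda>i::nat. x [^] i) {..<?n}"
    by (intro eq_card_imp_inj_on) (simp_all add: order_def)
  with im show ?thesis by (simp add: bij_betw_def)
qed

text \<open>Along the powers of a generator the sequence is -1 on \<open>D\<close> and 1 elsewhere.
  Expanding the product of two terms \<open>1 - 2 * \<chi>\<close> gives two linear sums
  \<open>k\<close> and one sum of products, which counts representations.\<close>

lemma difference_set_imp_binary_sequence:
  fixes G (structure)
  assumes "cyclic_difference_set G D n k l"
  obtains a where "binary_sequence n a"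
    and "\<And>t. t \<in> {1..n - 1} \<Longrightarrow> autocorrelation n a t = int n - 4 * int k + 4 * int l"
proof -
  interpret group G using assms by (simp add: cyclic_difference_set_def)
  have fin: "finite (carrier G)" and n: "n = order G" and D: "D \<subseteq> carrier G" "card D = k"
    and reps: "\<And>g. g \<in> carrier G - {\<one>} \<Longrightarrow>
        card {(y, z). y \<in> D \<and> z \<in> D \<and> g = y \<otimes> inv z} = l"
    using assms by (auto simp: cyclic_difference_set_def)
  obtain x where x: "x \<in> carrier G" "carrier G = range (\<lambda>i::int. x [^] i)"
    using assms cyclic_group by (auto simp: cyclic_difference_set_def)
  have bij: "bij_betw (\<lambda>i::nat. x [^] i) {..<n} (carrier G)"
    unfolding n by (rule bij_betw_nat_pow_generator[OF fin x])
  have n0: "n > 0" using fin n order_gt_0_iff_finite by blast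
  have pown: "x [^] n = \<one>" using pow_order_eq_1[OF x(1)] n by simp
  have per: "x [^] (i + n) = x [^] i" for i :: nat
    using x(1) pown by (simp flip: nat_pow_mult)
  define \<chi> where "\<chi> i = (if x [^] i \<in> D then 1 else 0 :: int)" for i :: nat
  have sum_\<chi>: "(\<Sum>i<n. \<chi> i) = int k"
  proof -
    have "(\<Sum>i<n. \<chi> i) = (\<Sum>g\<in>carrier G. if g \<in> D then 1 else 0)"
      unfolding \<chi>_def by (rule sum.reindex_bij_betw[OF bij])
    also have "\<dots> = int (card (carrier G \<inter> D))" using fin by (simp add: sum.If_cases)
    finally show ?thesis using D by (simp add: Int_absorb1)
  qed
  have sum_\<chi>_shift: "(\<Sum>i<n. \<chi> (i + t)) = int k" for t
  proof -
    have "\<chi> (i mod n) = \<chi> i" for i by (rule periodic_mod) (simp add: \<chi>_def per)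
    hence "(\<Sum>i<n. \<chi> (i + t)) = (\<Sum>i<n. \<chi> ((t + i) mod n))" by (simp add: add.commute)
    also have "\<dots> = (\<Sum>i<n. \<chi> i)" by (rule sum.reindex_bij_betw[OF bij_betw_add_mod])
    finally show ?thesis by (simp add: sum_\<chi>)
  qed
  have sum_\<chi>\<chi>: "(\<Sum>i<n. \<chi> i * \<chi> (i + t)) = int l" if t: "t \<in> {1..n - 1}" for t
  proof -
    have "x [^] t \<noteq> \<one>"
    proof
      assume "x [^] t = \<one>"
      hence "x [^] t = x [^] (0::nat)" by simp
      hence "t = 0"
        by (rule inj_onD[OF bij_betw_imp_inj_on[OF bij]]) (use t n0 in auto)
      thus False using t by simp
    qed
    hence l: "l = card {(y, z). y \<in> D \<and> z \<in> D \<and> x [^] t = y \<otimes> inv z}"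
      using reps[of "x [^] t"] x(1) by simp
    \<comment> \<open>The index \<open>i\<close> stands for the pair
      \<open>(x [^] (i + t), x [^] i)\<close> with quotient \<open>x [^] t\<close>; one period meets
      each group element once, so each representation occurs once.\<close>
    let ?I = "{i. i < n \<and> x [^] i \<in> D \<and> x [^] (i + t) \<in> D}"
    have "bij_betw (\<lambda>i. (x [^] (i + t), x [^] i)) ?I
        {(y, z). y \<in> D \<and> z \<in> D \<and> x [^] t = y \<otimes> inv z}"
      unfolding bij_betw_def
    proof (intro conjI subset_antisym subsetI)
      show "inj_on (\<lambda>i. (x [^] (i + t), x [^] i)) ?I"
        using bij_betw_imp_inj_on[OF bij] by (auto simp: inj_on_def)
    next
      fix w assume "w \<in> (\<lambda>i. (x [^] (i + t), x [^] i)) ` ?I"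
      then obtain i where "w = (x [^] (i + t), x [^] i)" "i \<in> ?I" by blast
      moreover have "x [^] t = x [^] (i + t) \<otimes> inv (x [^] i)"
        using x(1) by (simp add: add.commute[of i] m_assoc flip: nat_pow_mult)
      ultimately show "w \<in> {(y, z). y \<in> D \<and> z \<in> D \<and> x [^] t = y \<otimes> inv z}" by simp
    next
      fix w assume "w \<in> {(y, z). y \<in> D \<and> z \<in> D \<and> x [^] t = y \<otimes> inv z}"
      then obtain y z where w: "w = (y, z)" "y \<in> D" "z \<in> D" "x [^] t = y \<otimes> inv z" by auto
      have yz: "y \<in> carrier G" "z \<in> carrier G" using w D by auto
      obtain i where i: "i < n" "z = x [^] i"
        using yz(2) bij by (auto simp: bij_betw_def)
      have "y = x [^] t \<otimes> z" using w(4) yz by (simp add: m_assoc)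
      hence "y = x [^] (i + t)" using i x(1) by (simp add: nat_pow_mult add.commute)
      thus "w \<in> (\<lambda>i. (x [^] (i + t), x [^] i)) ` ?I" using w i by auto
    qed
    hence "l = card ?I" unfolding l by (simp add: bij_betw_same_card)
    moreover have "(\<Sum>i<n. \<chi> i * \<chi> (i + t)) = (\<Sum>i<n. if i \<in> ?I then 1 else 0)"
      by (intro sum.cong) (auto simp: \<chi>_def)
    moreover have "\<dots> = int (card ({..<n} \<inter> ?I))"
      by (subst sum.If_cases) simp_all
    moreover have "{..<n} \<inter> ?I = ?I" by auto
    ultimately show ?thesis by simp
  qed
  define a where "a i = 1 - 2 * \<chi> i" for i
  show thesis
  proof (rule that[of a])
    show "binary_sequence n a"
      using n0 per by (auto simp: binary_sequence_def a_def \<chi>_def)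
  next
    fix t assume t: "t \<in> {1..n - 1}"
    have "autocorrelation n a t = (\<Sum>i<n. 1 - 2 * \<chi> i - 2 * \<chi> (i + t) + 4 * (\<chi> i * \<chi> (i + t)))"
      unfolding autocorrelation_def a_def
      by (intro sum.cong) (auto simp: algebra_simps)
    thus "autocorrelation n a t = int n - 4 * int k + 4 * int l"
      by (simp add: sum.distrib sum_subtractf sum_\<chi> sum_\<chi>_shift sum_\<chi>\<chi>[OF t] flip: sum_distrib_left)
  qed
qed

section \<open>Arithmetic modulo 5 and nonexistence\<close>

text \<open>Modulo 5, the number 4 is -1, and so are the squares 4 and 9 of 2 and 3.\<close>

lemma prime_power_eq_minus_one_mod_5:
  assumes "p mod 5 \<in> {2, 3, 4::nat}"
  obtains j where "j > 0" "of_nat (p ^ j) = (-1 :: 5)"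
proof -
  have "of_nat 5 = (0 :: 5)" by simp
  from of_nat_mod_modulus[OF this] have p: "of_nat p = (of_nat (p mod 5) :: 5)" by metis
  show thesis
  proof (cases "p mod 5 = 4")
    case True
    hence "of_nat (p ^ 1) = (-1 :: 5)" using p by simp
    thus ?thesis using that[of 1] by simp
  next
    case False
    hence "of_nat (p ^ 2) = (-1 :: 5)" using p assms by (auto simp: power2_eq_square)
    thus ?thesis using that[of 2] by simp
  qed
qed

theorem theorem2p5:
  fixes u :: nat
  assumes "u > 0"
    and "u mod 10 = 3 \<or> u mod 10 = 7"
    and "even (multiplicity 2 (u^2 - 1)) \<or>
         (\<exists>p::nat. prime p \<and> odd p \<and> p mod 5 \<in> {2, 3, 4} \<and>
            (odd (multiplicity p (u + 1)) \<or> odd (multiplicity p (u - 1))))"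
  shows "(\<nexists>(G :: 'a monoid) D. cyclic_difference_set G D
             ((u^2 + 1) div 2) ((u - 1)^2 div 4) ((u - 1) * (u - 3) div 8)) \<and>
         (\<nexists>a. binary_sequence ((u^2 + 1) div 2) a \<and>
             (\<forall>t \<in> {1..(u^2 + 1) div 2 - 1}. autocorrelation ((u^2 + 1) div 2) a t = 1))"
proof -
  define n where "n = (u\<^sup>2 + 1) div 2"
  obtain v where "u = 10 * v + 3 \<or> u = 10 * v + 7"
    using assms(2) by (metis mult_div_mod_eq)
  \<comment> \<open>The substitution clears the denominators. The residues 3 and 7 of
    \<open>u\<close> modulo 10 become 1 and 3 for \<open>w\<close> modulo 5, the roots of
    \<open>2 * w * w + 2 * w + 1\<close>.\<close>
  then obtain w where u: "u = 2 * w + 1" and v: "w = 5 * v + 1 \<or> w = 5 * v + 3"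
    using that[of "5 * v + 1"] that[of "5 * v + 3"] by fastforce
  have w0: "w > 0" using v by auto
  have n: "n = 2 * w * w + 2 * w + 1"
    by (simp add: n_def u power2_eq_square algebra_simps)
  have "5 dvd n" unfolding n using v
  proof
    assume "w = 5 * v + 1"
    hence "2 * w * w + 2 * w + 1 = 5 * (10 * v * v + 6 * v + 1)" by (simp add: algebra_simps)
    thus "5 dvd 2 * w * w + 2 * w + 1" by (metis dvd_triv_left)
  next
    assume "w = 5 * v + 3"
    hence "2 * w * w + 2 * w + 1 = 5 * (10 * v * v + 14 * v + 5)" by (simp add: algebra_simps)
    thus "5 dvd 2 * w * w + 2 * w + 1" by (metis dvd_triv_left)
  qed
  have no_seq: "\<not> (binary_sequence n a \<and> (\<forall>t \<in> {1..n - 1}. autocorrelation n a t = 1))" for a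
  proof
    assume a: "binary_sequence n a \<and> (\<forall>t \<in> {1..n - 1}. autocorrelation n a t = 1)"
    have even_mult: "even (multiplicity p (n - 1))" if p: "prime p" "p mod 5 \<in> {2, 3, 4}" for p
    proof -
      obtain j where "j > 0" "of_nat (p ^ j) = (-1 :: 5)"
        using prime_power_eq_minus_one_mod_5 p(2) by blast
      thus ?thesis
        using even_multiplicity_of_flat_autocorrelation[OF p(1) _ _ \<open>5 dvd n\<close> _ , of _ a] a n
        by auto
    qed
    have u2: "u\<^sup>2 - 1 = 2 * (n - 1)" and n1: "n - 1 \<noteq> 0"
      using w0 by (simp_all add: n u power2_eq_square algebra_simps)
    have prod: "2 * (n - 1) = (u + 1) * (u - 1)"
      by (simp add: n u algebra_simps)
    from assms(3) show False
    proof
      assume "even (multiplicity 2 (u\<^sup>2 - 1))"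
      \<comment> \<open>The extra factor 2 flips the parity, while \<open>even_mult\<close> covers
        the prime 2 as well.\<close>
      moreover have "multiplicity 2 (u\<^sup>2 - 1) = Suc (multiplicity 2 (n - 1))"
        unfolding u2 using n1 by (intro multiplicity_times_same) auto
      ultimately show False using even_mult[of 2] by simp
    next
      assume "\<exists>p::nat. prime p \<and> odd p \<and> p mod 5 \<in> {2, 3, 4} \<and>
        (odd (multiplicity p (u + 1)) \<or> odd (multiplicity p (u - 1)))"
      then obtain p :: nat where p: "prime p" "odd p" "p mod 5 \<in> {2, 3, 4}"
        and odd: "odd (multiplicity p (u + 1)) \<or> odd (multiplicity p (u - 1))" by blast
      have "\<not> p dvd 2" using p(1,2) primes_dvd_imp_eq two_is_prime_nat by blast
      have "multiplicity p (2 * (n - 1)) = multiplicity p 2 + multiplicity p (n - 1)"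
        using p(1) n1 by (intro prime_elem_multiplicity_mult_distrib) auto
      moreover have "multiplicity p (2 * (n - 1)) = multiplicity p (u + 1) + multiplicity p (u - 1)"
        unfolding prod using p(1) w0 by (intro prime_elem_multiplicity_mult_distrib) (auto simp: u)
      \<comment> \<open>A common divisor of \<open>u + 1\<close> and \<open>u - 1\<close> divides 2,
        so an odd \<open>p\<close> divides at most one of them and the sum of the two multiplicities
        is odd.\<close>
      moreover have "multiplicity p (u + 1) = 0 \<or> multiplicity p (u - 1) = 0"
      proof -
        have "\<not> (p dvd u + 1 \<and> p dvd u - 1)"
        proof
          assume "p dvd u + 1 \<and> p dvd u - 1"
          hence "p dvd (u + 1) - (u - 1)" by (metis dvd_diff_nat)
          thus False using \<open>\<not> p dvd 2\<close> u by simp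
        qed
        thus ?thesis using not_dvd_imp_multiplicity_0[of p] by metis
      qed
      ultimately show False
        using even_mult[OF p(1,3)] odd \<open>\<not> p dvd 2\<close> by (auto simp: not_dvd_imp_multiplicity_0)
    qed
  qed
  have "\<not> cyclic_difference_set G D n ((u - 1)^2 div 4) ((u - 1) * (u - 3) div 8)"
    for G :: "'a monoid" and D
  proof
    assume ds: "cyclic_difference_set G D n ((u - 1)^2 div 4) ((u - 1) * (u - 3) div 8)"
    have k: "(u - 1)^2 div 4 = w * w" by (simp add: u power2_eq_square)
    \<comment> \<open>This makes the division by 8 exact.\<close>
    have "even (w * (w - 1))" by (cases "even w") simp_all
    then obtain e where e: "w * (w - 1) = 2 * e" by (elim evenE)
    have "(u - 1) * (u - 3) = 4 * (w * (w - 1))" by (simp add: u algebra_simps diff_mult_distrib2)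
    hence "(u - 1) * (u - 3) = 8 * e" unfolding e by simp
    hence l: "(u - 1) * (u - 3) div 8 = e" by simp
    have "2 * int e = int w * (int w - 1)"
      using arg_cong[OF e, of int] w0 by (simp add: of_nat_diff)
    \<comment> \<open>With \<open>k = w * w\<close> and \<open>l = e\<close>, the off-peak
      autocorrelation is 1, which \<open>no_seq\<close> excludes.\<close>
    hence "int n - 4 * int (w * w) + 4 * int e = 1" by (simp add: n algebra_simps)
    thus False
      using difference_set_imp_binary_sequence[OF ds[unfolded k l]] no_seq by metis
  qed
  thus ?thesis using no_seq unfolding n_def by blast
qed

end
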